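(* Let $X$ be a Banach space and let $T\in C(X)$ be an asymptotically compact map with $x^\ast$ as an $\mathfrak{L}$-hyperbolic equilibrium. Then there exists $\delta>0$ such that, if $\xi\colon\mathbb Z\to X$ is a global solution of $T$ with $\|\xi(m)-x^\ast\|<\delta$ for all $m\geqslant 0$ (respectively, for all $m\leqslant 0$), then $\xi(m)\to x^\ast$ as $m\to\infty$ (respectively, as $m\to-\infty$).
   Context: $C(X)$ is the set of continuous maps $X\to X$. An equilibrium point of $T$ is $x^\ast$ with $T(x^\ast)=x^\ast$. A global solution of $T$ is a function $\xi\colon\mathbb Z\to X$ with $T(\xi(m))=\xi(m+1)$ for all $m\in\mathbb Z$. $T$ is asymptotically compact if, whenever $n_k\to\infty$ in $\mathbb N$ and $\{x_k\}$ is bounded in $X$ with $\{T^{n_k}(x_k)\}$ bounded, the sequence $\{T^{n_k}(x_k)\}$ has a convergent subsequence. A map is bi-Lipschitz if it is invertible and it and its inverse are Lipschitz. Weakly hyperbolic points. Let $L$ be a bounded linear operator on $X$ with $\sigma(L)\cap\{|\lambda|=1\}=\varnothing$. Put $\pi_s=\frac1{2\pi i}\int_{|\lambda|=1}(\lambda-L)^{-1}d\lambda$, $\pi_u=I-\pi_s$, $X_j=\pi_jX$, $L_j=L|_{X_j}$ ($j=u,s$). One has $0<b<1<a$ with $\sigma(L_s)\subset\{|\lambda|<b\}$, $\sigma(L_u)\subset\{|\lambda|>a\}$, and $X$ is equipped with an equivalent norm satisfying $\|L_s\|\leqslant b$, $\|L_u^{-1}\|\leqslant a^{-1}$, $\|x_u+x_s\|=\max\{\|x_u\|,\|x_s\|\}$.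 An equilibrium point $x^\ast$ of $T$ is weakly hyperbolic if $S(x)=T(x+x^\ast)-x^\ast$ has a decomposition $S=L+N$ with: (i) $L,a,b$ and the norm as just described; (ii) there are a neighborhood $U_0$ of $0$ and $\gamma={\rm Lip}(N)>0$ with $b+2\gamma<1<a-2\gamma$ and $\|N(x)-N(y)\|\leqslant\gamma\|x-y\|$ on $U_0$; (iii) $0<\gamma\|(I-L)^{-1}\|\leqslant1$. Local manifolds. For a weakly hyperbolic point $x^\ast$ of $T$, $W^{\rm s}_{loc}(x^\ast)$ and $W^{\rm u}_{loc}(x^\ast)$ denote the local stable and unstable manifolds: for suitable $\epsilon_0>0$ and neighborhoods $U$ of $x^\ast$ and $V_u,V_s$ of $0$ in $X_u,X_s$, they are graphs of Lipschitz maps over $x^\ast+V_s$ and $x^\ast+V_u$ respectively, and $W^{\rm s}_{loc}(x^\ast)=\{x\in U: T^nx\in U\ \forall n\geqslant0,\ \|T^nx-x^\ast\|=o((1-\epsilon_0)^n)\}$, $W^{\rm u}_{loc}(x^\ast)=\{x\in U:\exists\{x_j\}_{j\leqslant0}\subset U,\ x_0=x,\ x_{j+1}=T(x_j),\ \sup_{j\leqslant0}(1+\epsilon_0)^{-j}\|x_j-x^\ast\|<\infty\}$. $\mathfrak L$-hyperbolic points. A weakly hyperbolic point $x^\ast$ of $T$, with decomposition $S=L+N$, is $\mathfrak L$-hyperbolic if ${\rm Lip}(N)<\gamma_1$, where $\gamma_1=\gamma_1(L)>0$ is a constant (whose existence the paper proves) with the following property: if $R\in C(X)$ has $0$ as a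 weakly hyperbolic point with decomposition $R=L+N$ and ${\rm Lip}(N)<\gamma_1$, then there are neighborhoods $O,V_u,V_s$ of $0$ in $X,X_u,X_s$ and a bi-Lipschitz map $g\colon X\to X$ with $g(0)=0$ such that $0$ is a weakly hyperbolic point of $R_1=g^{-1}\circ R\circ g$ with decomposition $R_1=L+N_1$, and the local manifolds of $0$ for $R_1$ satisfy $W^{\rm u,1}_{loc}(0)\cap O=V_u$, $W^{\rm s,1}_{loc}(0)\cap O=V_s$; in particular $\pi_uN_1(x_s)=0=\pi_sN_1(x_u)$ for $x_u\in V_u$, $x_s\in V_s$. *)

theory Defs
  imports "HOL-Analysis.Analysis" "HOL-Library.Landau_Symbols"
begin

text \<open>
  The phase space is a real Banach space, and spectral notions refer to its complexification,
  modelled on pairs, where \<open>(x, y)\<close> stands for \<open>x + i y\<close>. The product norm generates the topology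
  of the complexification, which is all that the notions below depend on.
  Complex Banach spaces are included by forgetting the complex structure: for a complex-linear
  operator \<open>A\<close> the complexification is the direct sum of \<open>A\<close> and its conjugate. Hence the spectrum
  below is the usual one together with its complex conjugate, and conditions on the modulus of
  the spectrum as well as the spectral projection for the unit disc are the usual ones.
\<close>

definition cscale :: "complex \<Rightarrow> 'a::real_vector \<times> 'a \<Rightarrow> 'a \<times> 'a" where
  "cscale c = (\<lambda>(x, y). (Re c *\<^sub>R x - Im c *\<^sub>R y, Im c *\<^sub>R x + Re c *\<^sub>R y))"

text \<open>The operator \<open>\<lambda> - A\<close> on the complexification.\<close>

definition cshift :: "('a::real_vector \<Rightarrow> 'a) \<Rightarrow> complex \<Rightarrow> 'a \<times> 'a \<Rightarrow> 'a \<times> 'a" where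
  "cshift A l z = cscale l z - map_prod A A z"

text \<open>The spectrum of the restriction of \<open>A\<close> to an invariant subspace \<open>V\<close>.\<close>

definition spectrum_on :: "'a::real_normed_vector set \<Rightarrow> ('a \<Rightarrow> 'a) \<Rightarrow> complex set" where
  "spectrum_on V A = {l. \<not> (bij_betw (cshift A l) (V \<times> V) (V \<times> V) \<and>
     (\<exists>C. \<forall>z \<in> V \<times> V. norm (inv_into (V \<times> V) (cshift A l) z) \<le> C * norm z))}"

text \<open>
  The projection \<open>(2 \<pi> i)^-1 \<integral> (\<lambda> - L)^-1 d\<lambda>\<close> over the positively oriented unit circle. With
  \<open>\<lambda> = cis t\<close> one has \<open>d\<lambda> = i \<lambda> dt\<close>, which leaves \<open>(2 \<pi>)^-1 \<integral> \<lambda> (\<lambda> - L)^-1 dt\<close>. The integral is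
  taken in the Banach space of bounded operators on the complexification.
\<close>

definition riesz_projection ::
    "('a::banach \<Rightarrow>\<^sub>L 'a) \<Rightarrow> ('a \<times> 'a) \<Rightarrow>\<^sub>L ('a \<times> 'a)" where
  "riesz_projection L = (1 / (2 * pi)) *\<^sub>R
     integral {0..2 * pi} (\<lambda>t. Blinfun (\<lambda>z. cscale (cis t) (inv (cshift (blinfun_apply L) (cis t)) z)))"

text \<open>The projection commutes with conjugation, so it maps \<open>(x, 0)\<close> to a pair of the form \<open>(y, 0)\<close>.\<close>

definition proj_s :: "('a::banach \<Rightarrow>\<^sub>L 'a) \<Rightarrow> 'a \<Rightarrow> 'a" where
  "proj_s L x = fst (blinfun_apply (riesz_projection L) (x, 0))"

definition proj_u :: "('a::banach \<Rightarrow>\<^sub>L 'a) \<Rightarrow> 'a \<Rightarrow> 'a" where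
  "proj_u L x = x - proj_s L x"

abbreviation space_s :: "('a::banach \<Rightarrow>\<^sub>L 'a) \<Rightarrow> 'a set" where
  "space_s L \<equiv> range (proj_s L)"

abbreviation space_u :: "('a::banach \<Rightarrow>\<^sub>L 'a) \<Rightarrow> 'a set" where
  "space_u L \<equiv> range (proj_u L)"

definition equivalent_norm :: "('a::real_normed_vector \<Rightarrow> real) \<Rightarrow> bool" where
  "equivalent_norm nrm \<longleftrightarrow>
     (\<forall>x y. nrm (x + y) \<le> nrm x + nrm y) \<and>
     (\<forall>c x. nrm (c *\<^sub>R x) = \<bar>c\<bar> * nrm x) \<and>
     (\<exists>c>0. \<exists>C>0. \<forall>x. c * norm x \<le> nrm x \<and> nrm x \<le> C * norm x)"

text \<open>
  The norm of the restriction of \<open>A\<close> to \<open>V\<close>, with respect to \<open>nrm\<close>;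
  \<open>opnorm_on norm UNIV\<close> is \<^const>\<open>onorm\<close>.
\<close>

definition opnorm_on :: "('a::real_vector \<Rightarrow> real) \<Rightarrow> 'a set \<Rightarrow> ('a \<Rightarrow> 'a) \<Rightarrow> real" where
  "opnorm_on nrm V A = (SUP x\<in>V. nrm (A x) / nrm x)"

definition hyperbolic_operator ::
    "('a::banach \<Rightarrow>\<^sub>L 'a) \<Rightarrow> real \<Rightarrow> real \<Rightarrow> ('a \<Rightarrow> real) \<Rightarrow> bool" where
  "hyperbolic_operator L a b nrm \<longleftrightarrow>
     spectrum_on UNIV (blinfun_apply L) \<inter> {l. cmod l = 1} = {} \<and>
     0 < b \<and> b < 1 \<and> 1 < a \<and>
     spectrum_on (space_s L) (blinfun_apply L) \<subseteq> {l. cmod l < b} \<and>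
     spectrum_on (space_u L) (blinfun_apply L) \<subseteq> {l. cmod l > a} \<and>
     equivalent_norm nrm \<and>
     opnorm_on nrm (space_s L) (blinfun_apply L) \<le> b \<and>
     opnorm_on nrm (space_u L) (inv_into (space_u L) (blinfun_apply L)) \<le> inverse a \<and>
     (\<forall>xu \<in> space_u L. \<forall>xs \<in> space_s L. nrm (xu + xs) = max (nrm xu) (nrm xs))"

text \<open>
  The point \<open>p\<close> is a weakly hyperbolic point of \<open>T\<close> with decomposition \<open>T (x + p) - p = L x + N x\<close>.
  The number \<open>g\<close> is the Lipschitz constant written \<open>Lip(N)\<close>: a positive constant that works
  for \<open>N\<close> near \<open>0\<close>, not necessarily the smallest one (so that \<open>N = 0\<close> is allowed).
\<close>

definition weakly_hyperbolic_decomp ::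
    "('a::banach \<Rightarrow>\<^sub>L 'a) \<Rightarrow> real \<Rightarrow> real \<Rightarrow> ('a \<Rightarrow> real) \<Rightarrow> ('a \<Rightarrow> 'a) \<Rightarrow> 'a \<Rightarrow> ('a \<Rightarrow> 'a) \<Rightarrow> real \<Rightarrow> bool"
  where
  "weakly_hyperbolic_decomp L a b nrm T p N g \<longleftrightarrow>
     T p = p \<and>
     (\<forall>x. T (x + p) - p = blinfun_apply L x + N x) \<and>
     hyperbolic_operator L a b nrm \<and>
     0 < g \<and> b + 2 * g < 1 \<and> 1 < a - 2 * g \<and>
     (\<exists>U0. 0 \<in> interior U0 \<and> (\<forall>x\<in>U0. \<forall>y\<in>U0. nrm (N x - N y) \<le> g * nrm (x - y))) \<and>
     0 < g * opnorm_on nrm UNIV (inv (\<lambda>x. x - blinfun_apply L x)) \<and>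
     g * opnorm_on nrm UNIV (inv (\<lambda>x. x - blinfun_apply L x)) \<le> 1"

definition loc_stable ::
    "('a::real_normed_vector \<Rightarrow> real) \<Rightarrow> ('a \<Rightarrow> 'a) \<Rightarrow> 'a \<Rightarrow> real \<Rightarrow> 'a set \<Rightarrow> 'a set" where
  "loc_stable nrm T p e U =
     {x \<in> U. (\<forall>n. (T ^^ n) x \<in> U) \<and> (\<lambda>n. nrm ((T ^^ n) x - p)) \<in> o(\<lambda>n. (1 - e) ^ n)}"

definition loc_unstable ::
    "('a::real_normed_vector \<Rightarrow> real) \<Rightarrow> ('a \<Rightarrow> 'a) \<Rightarrow> 'a \<Rightarrow> real \<Rightarrow> 'a set \<Rightarrow> 'a set" where
  "loc_unstable nrm T p e U =
     {x \<in> U. \<exists>y :: int \<Rightarrow> 'a. (\<forall>j\<le>0. y j \<in> U) \<and> y 0 = x \<and> (\<forall>j<0. y (j + 1) = T (y j)) \<and>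
        bdd_above ((\<lambda>j. (1 + e) powi (- j) * nrm (y j - p)) ` {..0})}"

definition nbhd_in :: "'a::topological_space set \<Rightarrow> 'a \<Rightarrow> 'a set \<Rightarrow> bool" where
  "nbhd_in S p V \<longleftrightarrow> V \<subseteq> S \<and> (\<exists>W. open W \<and> p \<in> W \<and> W \<inter> S \<subseteq> V)"

text \<open>
  The set \<open>W\<close> is the graph, over \<open>p + V\<close>, of a Lipschitz map into the complementary directions \<open>Y\<close>.
  (The Lipschitz property does not depend on the choice of an equivalent norm.)
\<close>

definition lipschitz_graph ::
    "'a::real_normed_vector \<Rightarrow> 'a set \<Rightarrow> 'a set \<Rightarrow> 'a set \<Rightarrow> bool" where
  "lipschitz_graph p V Y W \<longleftrightarrow>
     (\<exists>h C. h ` V \<subseteq> Y \<and> C-lipschitz_on V h \<and> W = (\<lambda>v. p + v + h v) ` V)"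

text \<open>
  The local manifolds depend on the choice of \<open>e\<close> (that is, \<open>\<epsilon>\<^sub>0\<close>) and \<open>U\<close>; a choice is suitable
  if both sets are Lipschitz graphs over neighbourhoods of \<open>0\<close> in the two subspaces.
\<close>

definition loc_manifold_params ::
    "('a::banach \<Rightarrow>\<^sub>L 'a) \<Rightarrow> ('a \<Rightarrow> real) \<Rightarrow> ('a \<Rightarrow> 'a) \<Rightarrow> 'a \<Rightarrow> real \<Rightarrow> 'a set \<Rightarrow> bool" where
  "loc_manifold_params L nrm T p e U \<longleftrightarrow>
     0 < e \<and> e < 1 \<and> p \<in> interior U \<and>
     (\<exists>Vu Vs. nbhd_in (space_u L) 0 Vu \<and> nbhd_in (space_s L) 0 Vs \<and>
        lipschitz_graph p Vs (space_u L) (loc_stable nrm T p e U) \<and>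
        lipschitz_graph p Vu (space_s L) (loc_unstable nrm T p e U))"

definition bi_lipschitz :: "('a::metric_space \<Rightarrow> 'a) \<Rightarrow> bool" where
  "bi_lipschitz g \<longleftrightarrow>
     bij g \<and> (\<exists>C. C-lipschitz_on UNIV g) \<and> (\<exists>C. C-lipschitz_on UNIV (inv g))"

text \<open>
  The property required of the constant \<open>\<gamma>\<^sub>1(L)\<close>. Together with \<open>L\<close>, the numbers \<open>a\<close>, \<open>b\<close> and the
  norm are fixed.
\<close>

definition straightening_const ::
    "('a::banach \<Rightarrow>\<^sub>L 'a) \<Rightarrow> real \<Rightarrow> real \<Rightarrow> ('a \<Rightarrow> real) \<Rightarrow> real \<Rightarrow> bool" where
  "straightening_const L a b nrm g1 \<longleftrightarrow>
     0 < g1 \<and>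
     (\<forall>R N c. continuous_on UNIV R \<longrightarrow> weakly_hyperbolic_decomp L a b nrm R 0 N c \<longrightarrow> c < g1 \<longrightarrow>
        (\<exists>B Vu Vs g N1 c1 e U.
           0 \<in> interior B \<and> nbhd_in (space_u L) 0 Vu \<and> nbhd_in (space_s L) 0 Vs \<and>
           bi_lipschitz g \<and> g 0 = 0 \<and>
           weakly_hyperbolic_decomp L a b nrm (inv g \<circ> R \<circ> g) 0 N1 c1 \<and>
           loc_manifold_params L nrm (inv g \<circ> R \<circ> g) 0 e U \<and>
           loc_unstable nrm (inv g \<circ> R \<circ> g) 0 e U \<inter> B = Vu \<and>
           loc_stable nrm (inv g \<circ> R \<circ> g) 0 e U \<inter> B = Vs \<and>
           (\<forall>xs\<in>Vs. proj_u L (N1 xs) = 0) \<and> (\<forall>xu\<in>Vu. proj_s L (N1 xu) = 0)))"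

definition L_hyperbolic :: "('a::banach \<Rightarrow> 'a) \<Rightarrow> 'a \<Rightarrow> bool" where
  "L_hyperbolic T p \<longleftrightarrow>
     (\<exists>L a b nrm N g g1. weakly_hyperbolic_decomp L a b nrm T p N g \<and>
        straightening_const L a b nrm g1 \<and> g < g1)"

definition global_solution :: "('a \<Rightarrow> 'a) \<Rightarrow> (int \<Rightarrow> 'a) \<Rightarrow> bool" where
  "global_solution T \<xi> \<longleftrightarrow> (\<forall>m. T (\<xi> m) = \<xi> (m + 1))"

definition asymptotically_compact :: "('a::metric_space \<Rightarrow> 'a) \<Rightarrow> bool" where
  "asymptotically_compact T \<longleftrightarrow>
     (\<forall>(n :: nat \<Rightarrow> nat) (x :: nat \<Rightarrow> 'a).
        filterlim n at_top sequentially \<longrightarrow> bounded (range x) \<longrightarrow>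
        bounded (range (\<lambda>k. (T ^^ n k) (x k))) \<longrightarrow>
        (\<exists>l r. strict_mono r \<and> ((\<lambda>k. (T ^^ n k) (x k)) \<circ> r) \<longlonglongrightarrow> l))"

end

theory Submission
  imports Defs
begin

text \<open>
  Write \<open>u\<close> and \<open>s\<close> for the sizes, in the adapted norm, of the unstable and the stable component
  of the deviation of a solution from the equilibrium. Near the equilibrium the nonlinear part has
  size at most \<open>\<gamma> max u s\<close>, which gives a dichotomy between two cones. Where \<open>s \<le> u\<close>, the next
  value of \<open>u\<close> is at least \<open>(a - \<gamma>) u\<close> while the next value of \<open>s\<close> is at most \<open>(b + \<gamma>) u\<close>: the
  unstable cone is mapped into itself and \<open>u\<close> is expanded there. Where \<open>u \<le> s\<close>, the next value
  of \<open>s\<close> is at most \<open>(b + \<gamma>) s\<close>. Here \<open>b + \<gamma> < 1 < a - \<gamma>\<close>.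

  A solution that stays near the equilibrium in forward time cannot be in the unstable cone away
  from the equilibrium, since \<open>u\<close> would grow geometrically. So either it reaches the equilibrium, or
  it stays in the stable cone, where it is contracted to the equilibrium. In backward time the roles
  are exchanged: leaving the unstable cone once means being outside it at all earlier times, where
  \<open>s\<close> grows geometrically towards the past; so the solution stays in the unstable cone and \<open>u\<close>
  decays towards the past.

  The dichotomy in terms of two real sequences is exploited in \<open>cone_dichotomy_forward\<close> and
  \<open>cone_dichotomy_backward\<close>, and it is established in \<open>weakly_hyperbolic_cone_step\<close>.
\<close>

section \<open>Bounded sequences with a cone dichotomy\<close>

lemma geometric_growth_bounded_imp_nonpos:
  fixes k x M :: real
  assumes "1 < k" and "\<And>n. k ^ n * x \<le> M"
  shows "x \<le> 0"
proof (rule ccontr)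
  assume "\<not> x \<le> 0"
  then have x: "0 < x" by simp
  obtain n where "M / x < k ^ n"
    using real_arch_pow[OF assms(1)] by blast
  then have "M < k ^ n * x" using x by (simp add: field_simps)
  with assms(2)[of n] show False by simp
qed

text \<open>
  Once in the cone \<open>s \<le> u\<close>, always in it, and \<open>u\<close> grows geometrically; a bound then forces
  \<open>u = 0\<close>. A sequence that never enters this cone is contracted at every step.
\<close>

lemma cone_dichotomy_forward:
  fixes u s :: "nat \<Rightarrow> real"
  assumes "1 < k" and "0 \<le> q" and "q < 1"
    and nonneg: "\<And>n. 0 \<le> u n" "\<And>n. 0 \<le> s n"
    and bound: "\<And>n. u n \<le> M"
    and unstable: "\<And>n. s n \<le> u n \<Longrightarrow> k * u n \<le> u (Suc n) \<and> s (Suc n) \<le> u (Suc n)"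
    and stable: "\<And>n. u n \<le> s n \<Longrightarrow> s (Suc n) \<le> q * s n"
  shows "(\<lambda>n. max (u n) (s n)) \<longlonglongrightarrow> 0"
proof (cases "\<exists>i. s i \<le> u i")
  case True
  then obtain i where i: "s i \<le> u i" by blast
  have grow: "s (j + n) \<le> u (j + n) \<and> k ^ n * u j \<le> u (j + n)" if j: "s j \<le> u j" for j n
  proof (induction n)
    case 0
    show ?case using j by simp
  next
    case (Suc n)
    have "k * (k ^ n * u j) \<le> k * u (j + n)"
      using Suc \<open>1 < k\<close> by (intro mult_left_mono) auto
    with unstable[of "j + n"] Suc show ?case by (auto simp: mult.assoc)
  qed
  have "max (u j) (s j) = 0" if "i \<le> j" for j
  proof -
    have j: "s j \<le> u j" using grow[OF i, of "j - i"] that by simp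
    have "u j \<le> 0"
    proof (rule geometric_growth_bounded_imp_nonpos[OF \<open>1 < k\<close>])
      show "k ^ n * u j \<le> M" for n
        using grow[OF j, of n] bound[of "j + n"] by linarith
    qed
    with j nonneg[of j] show ?thesis by linarith
  qed
  then show ?thesis
    by (intro tendsto_eventually) (auto simp: eventually_sequentially)
next
  case False
  then have out: "u n \<le> s n" for n by (meson linear)
  have "s n \<le> q ^ n * s 0" for n
  proof (induction n)
    case (Suc n)
    have "s (Suc n) \<le> q * s n" using stable out by blast
    also have "\<dots> \<le> q * (q ^ n * s 0)" using Suc \<open>0 \<le> q\<close> by (rule mult_left_mono)
    finally show ?case by (simp add: mult.assoc)
  qed simp
  moreover have "(\<lambda>n. q ^ n * s 0) \<longlonglongrightarrow> 0"
    using \<open>0 \<le> q\<close> \<open>q < 1\<close> by (intro tendsto_mult_left_zero LIMSEQ_realpow_zero)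
  ultimately have "s \<longlonglongrightarrow> 0"
    using nonneg(2) by (intro tendsto_sandwich[of "\<lambda>_. 0" s _ "\<lambda>n. q ^ n * s 0"]) auto
  then show ?thesis using out by (simp add: max_absorb2)
qed

text \<open>
  The same dichotomy read against time: the index \<open>Suc n\<close> is the predecessor of \<open>n\<close>. Positive
  invariance of the cone \<open>s \<le> u\<close> becomes invariance of its complement under going back, and there
  \<open>s\<close> grows geometrically, which the bound excludes.
\<close>

lemma cone_dichotomy_backward:
  fixes u s :: "nat \<Rightarrow> real"
  assumes "1 < k" and "0 < q" and "q < 1"
    and nonneg: "\<And>n. 0 \<le> u n" "\<And>n. 0 \<le> s n"
    and bound: "\<And>n. s n \<le> M"
    and unstable: "\<And>n. s (Suc n) \<le> u (Suc n) \<Longrightarrow> k * u (Suc n) \<le> u n \<and> s n \<le> u n"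
    and stable: "\<And>n. u (Suc n) \<le> s (Suc n) \<Longrightarrow> s n \<le> q * s (Suc n)"
  shows "(\<lambda>n. max (u n) (s n)) \<longlonglongrightarrow> 0"
proof -
  have cone: "s i \<le> u i" for i
  proof (rule ccontr)
    assume "\<not> s i \<le> u i"
    then have i: "u i < s i" by simp
    have grow: "u (i + n) < s (i + n) \<and> inverse q ^ n * s i \<le> s (i + n)" for n
    proof (induction n)
      case 0
      show ?case using i by simp
    next
      case (Suc n)
      have out: "u (Suc (i + n)) < s (Suc (i + n))"
        using unstable[of "i + n"] Suc by (meson not_le)
      have "inverse q * (inverse q ^ n * s i) \<le> inverse q * s (i + n)"
        using Suc \<open>0 < q\<close> by (intro mult_left_mono) auto
      also have "\<dots> \<le> s (Suc (i + n))"
        using stable[of "i + n"] out \<open>0 < q\<close> by (simp add: field_simps)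
      finally show ?case using out by (simp add: mult.assoc)
    qed
    have "s i \<le> 0"
    proof (rule geometric_growth_bounded_imp_nonpos)
      show "1 < inverse q" using \<open>0 < q\<close> \<open>q < 1\<close> by (rule one_less_inverse)
      show "inverse q ^ n * s i \<le> M" for n
        using grow[of n] bound[of "i + n"] by linarith
    qed
    with i nonneg(1)[of i] show False by linarith
  qed
  have "u n \<le> inverse k ^ n * u 0" for n
  proof (induction n)
    case (Suc n)
    have "u (Suc n) \<le> inverse k * u n"
      using unstable[of n] cone[of "Suc n"] \<open>1 < k\<close> by (simp add: field_simps)
    also have "\<dots> \<le> inverse k * (inverse k ^ n * u 0)"
      using Suc \<open>1 < k\<close> by (intro mult_left_mono) auto
    finally show ?case by (simp add: mult.assoc)
  qed simp
  moreover have "(\<lambda>n. inverse k ^ n * u 0) \<longlonglongrightarrow> 0"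
    using \<open>1 < k\<close> by (intro tendsto_mult_left_zero LIMSEQ_realpow_zero)
      (auto simp: inverse_less_1_iff)
  ultimately have "u \<longlonglongrightarrow> 0"
    using nonneg(1) by (intro tendsto_sandwich[of "\<lambda>_. 0" u _ "\<lambda>n. inverse k ^ n * u 0"]) auto
  then show ?thesis using cone by (simp add: max_absorb1)
qed

section \<open>Equivalent norms and operator bounds\<close>

lemma equivalent_norm_bounds:
  assumes "equivalent_norm nrm"
  obtains c C where "0 < c" "0 < C" "\<And>x. c * norm x \<le> nrm x" "\<And>x. nrm x \<le> C * norm x"
  using assms unfolding equivalent_norm_def by blast

lemma equivalent_norm_nonneg: "equivalent_norm nrm \<Longrightarrow> 0 \<le> nrm x"
  by (metis equivalent_norm_bounds mult_nonneg_nonneg less_imp_le norm_ge_zero order_trans)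

lemma equivalent_norm_eq_0_iff:
  assumes "equivalent_norm nrm"
  shows "nrm x = 0 \<longleftrightarrow> x = 0"
proof -
  obtain c C where *: "0 < c" "c * norm x \<le> nrm x" "nrm x \<le> C * norm x"
    using equivalent_norm_bounds[OF assms] by metis
  show ?thesis
  proof
    assume "nrm x = 0"
    with * have "c * norm x \<le> 0" by simp
    with \<open>0 < c\<close> show "x = 0" by (simp add: mult_le_0_iff)
  next
    assume "x = 0"
    with * show "nrm x = 0" by simp
  qed
qed

lemma equivalent_norm_triangle: "equivalent_norm nrm \<Longrightarrow> nrm (x + y) \<le> nrm x + nrm y"
  by (simp add: equivalent_norm_def)

lemma equivalent_norm_minus:
  assumes "equivalent_norm nrm"
  shows "nrm (- x) = nrm x"
proof -
  have "nrm ((-1) *\<^sub>R x) = \<bar>-1\<bar> * nrm x" using assms unfolding equivalent_norm_def by blast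
  then show ?thesis by simp
qed

text \<open>
  Without a bound on \<open>A\<close> the supremum that defines \<^const>\<open>opnorm_on\<close> could be over an unbounded set
  of real numbers and would then be an arbitrary number.
\<close>

lemma opnorm_on_bound:
  assumes nrm: "equivalent_norm nrm"
    and K: "\<And>x. x \<in> V \<Longrightarrow> norm (A x) \<le> K * norm x"
    and "x \<in> V"
  shows "nrm (A x) \<le> opnorm_on nrm V A * nrm x"
proof (cases "x = 0")
  case True
  with K[OF \<open>x \<in> V\<close>] show ?thesis
    by (simp add: equivalent_norm_eq_0_iff[OF nrm, THEN iffD2])
next
  case False
  obtain c C where *: "0 < c" "0 < C" "\<And>x. c * norm x \<le> nrm x" "\<And>x. nrm x \<le> C * norm x"
    using equivalent_norm_bounds[OF nrm] by metis
  have "nrm (A y) / nrm y \<le> C * \<bar>K\<bar> / c" if "y \<in> V" for y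
  proof (cases "y = 0")
    case True
    with * show ?thesis by (simp add: equivalent_norm_eq_0_iff[OF nrm, THEN iffD2])
  next
    case False
    have "nrm (A y) \<le> C * norm (A y)" by (rule *)
    also have "\<dots> \<le> C * (\<bar>K\<bar> * norm y)"
      using K[OF that] \<open>0 < C\<close> mult_right_mono[OF abs_ge_self[of K] norm_ge_zero[of y]]
      by (intro mult_left_mono) linarith+
    also have "\<dots> \<le> C * (\<bar>K\<bar> * (nrm y / c))"
      using * by (intro mult_left_mono) (auto simp: field_simps)
    finally have "nrm (A y) \<le> C * \<bar>K\<bar> / c * nrm y" by (simp add: field_simps)
    moreover have "0 < nrm y"
      using False equivalent_norm_eq_0_iff[OF nrm] equivalent_norm_nonneg[OF nrm]
      by (metis less_eq_real_def)
    ultimately show ?thesis by (simp add: pos_divide_le_eq)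
  qed
  then have "bdd_above ((\<lambda>x. nrm (A x) / nrm x) ` V)"
    by (auto simp: bdd_above_def)
  then have "nrm (A x) / nrm x \<le> opnorm_on nrm V A"
    unfolding opnorm_on_def using \<open>x \<in> V\<close> by (intro cSUP_upper)
  moreover have "0 < nrm x"
    using False equivalent_norm_eq_0_iff[OF nrm] equivalent_norm_nonneg[OF nrm]
    by (metis less_eq_real_def)
  ultimately show ?thesis by (simp add: pos_divide_le_eq)
qed

section \<open>Consequences of the spectral conditions\<close>

text \<open>
  The resolvent condition at a single point \<open>\<lambda>\<close> includes that \<open>\<lambda> - A\<close> maps the subspace onto
  itself, so it contains invariance under \<open>A\<close>. A real \<open>\<lambda>\<close> acts componentwise on pairs, which brings
  the condition down from the complexification to the subspace itself.
\<close>

lemma invariant_if_not_in_spectrum_on: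
  assumes "complex_of_real r \<notin> spectrum_on V A" and V: "subspace V" and "x \<in> V"
  shows "A x \<in> V"
proof -
  have "cshift A (complex_of_real r) ` (V \<times> V) = V \<times> V"
    using assms(1) by (simp add: spectrum_on_def bij_betw_def)
  moreover have "(x, 0) \<in> V \<times> V" using assms by (simp add: subspace_0)
  ultimately have "cshift A (complex_of_real r) (x, 0) \<in> V \<times> V" by blast
  then have "r *\<^sub>R x - A x \<in> V" by (simp add: cshift_def cscale_def)
  then have "r *\<^sub>R x - (r *\<^sub>R x - A x) \<in> V"
    using V \<open>x \<in> V\<close> by (meson subspace_diff subspace_scale)
  then show ?thesis by simp
qed

text \<open>
  At \<open>\<lambda> = 0\<close> the resolvent condition concerns \<open>- A\<close> acting on both components of a pair, so the
  pairs \<open>(v, 0)\<close> carry the invertibility of \<open>A\<close> itself.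
\<close>

lemma bounded_inverse_if_0_not_in_spectrum_on:
  assumes spec: "0 \<notin> spectrum_on V A" and V: "subspace V" and A0: "A 0 = 0"
  shows "inj_on A V" and "\<exists>K. \<forall>v\<in>V. norm (inv_into V A v) \<le> K * norm v"
proof -
  let ?B = "cshift A 0"
  have B: "?B (x, y) = (- A x, - A y)" for x y
    by (simp add: cshift_def cscale_def)
  have inj: "inj_on ?B (V \<times> V)" and im: "?B ` (V \<times> V) = V \<times> V"
    and "\<exists>K. \<forall>z\<in>V \<times> V. norm (inv_into (V \<times> V) ?B z) \<le> K * norm z"
    using spec by (auto simp: spectrum_on_def bij_betw_def)
  then obtain K where K: "\<And>z. z \<in> V \<times> V \<Longrightarrow> norm (inv_into (V \<times> V) ?B z) \<le> K * norm z"
    by blast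
  have V0: "0 \<in> V" using V by (rule subspace_0)
  show injA: "inj_on A V"
  proof (rule inj_onI)
    fix x y assume "x \<in> V" "y \<in> V" "A x = A y"
    then show "x = y" using inj_onD[OF inj, of "(x, 0)" "(y, 0)"] V0 by (simp add: B)
  qed
  have "norm (inv_into V A v) \<le> K * norm v" if "v \<in> V" for v
  proof -
    have "(- v, 0) \<in> ?B ` (V \<times> V)" using im V V0 that by (simp add: subspace_neg)
    then obtain w where w: "w \<in> V" "A w = v" by (auto simp: B)
    have "inv_into (V \<times> V) ?B (- v, 0) = (w, 0)"
      using inj w V0 A0 by (intro inv_into_f_eq) (auto simp: B)
    moreover have "inv_into V A v = w" using injA w by (intro inv_into_f_eq)
    moreover have "norm (inv_into (V \<times> V) ?B (- v, 0)) \<le> K * norm (- v, 0::'a)"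
      using V V0 that by (intro K) (simp add: subspace_neg)
    ultimately show ?thesis by (simp add: norm_Pair)
  qed
  then show "\<exists>K. \<forall>v\<in>V. norm (inv_into V A v) \<le> K * norm v" by blast
qed

lemma linear_proj_s: "linear (proj_s L)"
proof (rule linearI)
  fix x y :: 'a and c :: real
  show "proj_s L (x + y) = proj_s L x + proj_s L y"
    using blinfun.add_right[of "riesz_projection L" "(x, 0)" "(y, 0)"] by (simp add: proj_s_def)
  show "proj_s L (c *\<^sub>R x) = c *\<^sub>R proj_s L x"
    using blinfun.scaleR_right[of "riesz_projection L" c "(x, 0)"] by (simp add: proj_s_def)
qed

lemma linear_proj_u: "linear (proj_u L)"
  unfolding proj_u_def[abs_def] by (intro linear_compose_sub linear_ident linear_proj_s)

lemma subspace_space_s: "subspace (space_s L)"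
  by (intro linear_subspace_image linear_proj_s subspace_UNIV)

lemma subspace_space_u: "subspace (space_u L)"
  by (intro linear_subspace_image linear_proj_u subspace_UNIV)

text \<open>
  The maximum property of the adapted norm makes the two subspaces independent: for \<open>d\<close> in both,
  \<open>d\<close> and \<open>- d\<close> have sum zero, and the norm of this sum is the norm of \<open>d\<close>. So components are unique.
\<close>

lemma hyperbolic_operator_direct_sum:
  assumes hyp: "hyperbolic_operator L a b nrm"
    and "y \<in> space_u L" "z \<in> space_s L"
  shows "proj_u L (y + z) = y" and "proj_s L (y + z) = z"
proof -
  have nrm: "equivalent_norm nrm"
    and max_norm: "\<And>xu xs. xu \<in> space_u L \<Longrightarrow> xs \<in> space_s L \<Longrightarrow> nrm (xu + xs) = max (nrm xu) (nrm xs)"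
    using hyp unfolding hyperbolic_operator_def by blast+
  let ?d = "y - proj_u L (y + z)"
  have d: "?d = - (z - proj_s L (y + z))" by (simp add: proj_u_def)
  have "?d \<in> space_u L" using subspace_space_u \<open>y \<in> space_u L\<close> by (intro subspace_diff) auto
  moreover have "- ?d \<in> space_s L"
    unfolding d using subspace_space_s \<open>z \<in> space_s L\<close> by (simp, intro subspace_diff) auto
  ultimately have "nrm (?d + - ?d) = max (nrm ?d) (nrm (- ?d))" by (rule max_norm)
  then have "nrm ?d = 0"
    using equivalent_norm_minus[OF nrm, of ?d] equivalent_norm_eq_0_iff[OF nrm, of 0] by simp
  then show "proj_u L (y + z) = y" by (simp add: equivalent_norm_eq_0_iff[OF nrm])
  then show "proj_s L (y + z) = z" by (simp add: proj_u_def algebra_simps)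
qed

lemma hyperbolic_operator_norm_eq_max:
  assumes "hyperbolic_operator L a b nrm"
  shows "nrm x = max (nrm (proj_u L x)) (nrm (proj_s L x))"
proof -
  have "nrm (proj_u L x + proj_s L x) = max (nrm (proj_u L x)) (nrm (proj_s L x))"
    using assms unfolding hyperbolic_operator_def by blast
  then show ?thesis by (simp add: proj_u_def)
qed

lemma hyperbolic_operator_contracts_space_s:
  assumes hyp: "hyperbolic_operator L a b nrm" and "x \<in> space_s L"
  shows "blinfun_apply L x \<in> space_s L" and "nrm (blinfun_apply L x) \<le> b * nrm x"
proof -
  have nrm: "equivalent_norm nrm" and "b < 1"
    and spec: "spectrum_on (space_s L) (blinfun_apply L) \<subseteq> {l. cmod l < b}"
    and op: "opnorm_on nrm (space_s L) (blinfun_apply L) \<le> b"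
    using hyp unfolding hyperbolic_operator_def by blast+
  \<comment> \<open>Any real number above \<open>b\<close> is in the resolvent set and yields invariance.\<close>
  have "complex_of_real 1 \<notin> spectrum_on (space_s L) (blinfun_apply L)"
    using spec \<open>b < 1\<close> by auto
  then show "blinfun_apply L x \<in> space_s L"
    using subspace_space_s \<open>x \<in> space_s L\<close> by (rule invariant_if_not_in_spectrum_on)
  have "nrm (blinfun_apply L x) \<le> opnorm_on nrm (space_s L) (blinfun_apply L) * nrm x"
    using nrm norm_blinfun \<open>x \<in> space_s L\<close> by (rule opnorm_on_bound)
  also have "\<dots> \<le> b * nrm x"
    using op equivalent_norm_nonneg[OF nrm] by (rule mult_right_mono)
  finally show "nrm (blinfun_apply L x) \<le> b * nrm x" .
qed

text \<open>The bound on the inverse of the restriction, applied to \<open>L x\<close>, is an expansion estimate.\<close>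

lemma hyperbolic_operator_expands_space_u:
  assumes hyp: "hyperbolic_operator L a b nrm" and "x \<in> space_u L"
  shows "blinfun_apply L x \<in> space_u L" and "a * nrm x \<le> nrm (blinfun_apply L x)"
proof -
  let ?V = "space_u L" and ?A = "blinfun_apply L"
  have nrm: "equivalent_norm nrm" and "1 < a"
    and spec: "spectrum_on ?V ?A \<subseteq> {l. cmod l > a}"
    and op: "opnorm_on nrm ?V (inv_into ?V ?A) \<le> inverse a"
    using hyp unfolding hyperbolic_operator_def by blast+
  have spec0: "0 \<notin> spectrum_on ?V ?A" using spec \<open>1 < a\<close> by auto
  have "complex_of_real 0 \<notin> spectrum_on ?V ?A" using spec0 by simp
  then show Lx: "?A x \<in> ?V"
    using subspace_space_u \<open>x \<in> ?V\<close> by (rule invariant_if_not_in_spectrum_on)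
  note inv = bounded_inverse_if_0_not_in_spectrum_on[OF spec0 subspace_space_u blinfun.zero_right]
  obtain K where K: "\<And>v. v \<in> ?V \<Longrightarrow> norm (inv_into ?V ?A v) \<le> K * norm v"
    using inv(2) by blast
  have "nrm x = nrm (inv_into ?V ?A (?A x))"
    using inv(1) \<open>x \<in> ?V\<close> by simp
  also have "\<dots> \<le> opnorm_on nrm ?V (inv_into ?V ?A) * nrm (?A x)"
    using nrm K Lx by (rule opnorm_on_bound)
  also have "\<dots> \<le> inverse a * nrm (?A x)"
    using op equivalent_norm_nonneg[OF nrm] by (rule mult_right_mono)
  finally show "a * nrm x \<le> nrm (?A x)" using \<open>1 < a\<close> by (simp add: field_simps)
qed

section \<open>The cone dichotomy at a weakly hyperbolic point\<close>

text \<open>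
  Since the decomposition is direct, the components of \<open>L x + w\<close> are \<open>L\<close> applied to the components
  of \<open>x\<close> plus the components of \<open>w\<close>, and the latter are at most \<open>nrm w\<close> in the maximum norm. The
  larger component of \<open>x\<close> has the size of \<open>x\<close>, so it controls the perturbation.
\<close>

lemma hyperbolic_operator_cone_step:
  assumes hyp: "hyperbolic_operator L a b nrm" and "0 < g" "b + g < 1" "1 < a - g"
    and w: "nrm w \<le> g * nrm x"
  defines "y \<equiv> blinfun_apply L x + w"
  shows "nrm (proj_s L x) \<le> nrm (proj_u L x) \<Longrightarrow>
      (a - g) * nrm (proj_u L x) \<le> nrm (proj_u L y) \<and> nrm (proj_s L y) \<le> nrm (proj_u L y)"
    and "nrm (proj_u L x) \<le> nrm (proj_s L x) \<Longrightarrow> nrm (proj_s L y) \<le> (b + g) * nrm (proj_s L x)"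
proof -
  have nrm: "equivalent_norm nrm" and "0 < b"
    using hyp unfolding hyperbolic_operator_def by blast+
  note nonneg = equivalent_norm_nonneg[OF nrm] and triangle = equivalent_norm_triangle[OF nrm]
  let ?A = "blinfun_apply L" and ?xu = "proj_u L x" and ?xs = "proj_s L x"
  let ?wu = "proj_u L w" and ?ws = "proj_s L w"
  note max_x = hyperbolic_operator_norm_eq_max[OF hyp, of x]
  have wu: "nrm ?wu \<le> g * nrm x" and ws: "nrm ?ws \<le> g * nrm x"
    using w hyperbolic_operator_norm_eq_max[OF hyp, of w] by auto
  have Lu: "?A ?xu \<in> space_u L" "a * nrm ?xu \<le> nrm (?A ?xu)"
    using hyperbolic_operator_expands_space_u[OF hyp, of ?xu] by auto
  have Ls: "?A ?xs \<in> space_s L" "nrm (?A ?xs) \<le> b * nrm ?xs"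
    using hyperbolic_operator_contracts_space_s[OF hyp, of ?xs] by auto
  have "y = ?A (?xu + ?xs) + (?wu + ?ws)" by (simp add: y_def proj_u_def)
  then have y: "y = (?A ?xu + ?wu) + (?A ?xs + ?ws)"
    unfolding blinfun.add_right by (simp add: add_ac)
  have "?A ?xu + ?wu \<in> space_u L" "?A ?xs + ?ws \<in> space_s L"
    using Lu(1) Ls(1) by (auto intro!: subspace_add subspace_space_u subspace_space_s)
  note comps = hyperbolic_operator_direct_sum[OF hyp this, folded y]
  have yu: "a * nrm ?xu - g * nrm x \<le> nrm (proj_u L y)"
  proof -
    have "nrm (?A ?xu) \<le> nrm (?A ?xu + ?wu) + nrm (- ?wu)"
      using triangle[of "?A ?xu + ?wu" "- ?wu"] by simp
    then show ?thesis
      using Lu(2) wu by (simp add: comps equivalent_norm_minus[OF nrm])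
  qed
  have ys: "nrm (proj_s L y) \<le> b * nrm ?xs + g * nrm x"
    using triangle[of "?A ?xs" ?ws] Ls(2) ws by (simp add: comps)
  show "(a - g) * nrm ?xu \<le> nrm (proj_u L y) \<and> nrm (proj_s L y) \<le> nrm (proj_u L y)"
    if le: "nrm ?xs \<le> nrm ?xu"
  proof -
    have x: "nrm x = nrm ?xu" using max_x le by simp
    have expand: "(a - g) * nrm ?xu \<le> nrm (proj_u L y)" using yu x by (simp add: algebra_simps)
    have "nrm (proj_s L y) \<le> b * nrm ?xu + g * nrm ?xu"
      using ys x mult_left_mono[OF le less_imp_le[OF \<open>0 < b\<close>]] by simp
    also have "\<dots> = (b + g) * nrm ?xu" by (simp add: algebra_simps)
    also have "\<dots> \<le> (a - g) * nrm ?xu"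
      using \<open>b + g < 1\<close> \<open>1 < a - g\<close> nonneg by (intro mult_right_mono) auto
    finally show ?thesis using expand by simp
  qed
  show "nrm (proj_s L y) \<le> (b + g) * nrm ?xs" if "nrm ?xu \<le> nrm ?xs"
    using ys max_x that by (simp add: algebra_simps)
qed

lemma weakly_hyperbolic_cone_step:
  assumes wh: "weakly_hyperbolic_decomp L a b nrm T p N g"
  shows "\<exists>d>0. \<forall>x. norm (x - p) < d \<longrightarrow>
      (nrm (proj_s L (x - p)) \<le> nrm (proj_u L (x - p)) \<longrightarrow>
        (a - g) * nrm (proj_u L (x - p)) \<le> nrm (proj_u L (T x - p)) \<and>
        nrm (proj_s L (T x - p)) \<le> nrm (proj_u L (T x - p))) \<and>
      (nrm (proj_u L (x - p)) \<le> nrm (proj_s L (x - p)) \<longrightarrow>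
        nrm (proj_s L (T x - p)) \<le> (b + g) * nrm (proj_s L (x - p)))"
proof -
  have fix_p: "T p = p" and dec: "\<And>x. T (x + p) - p = blinfun_apply L x + N x"
    and hyp: "hyperbolic_operator L a b nrm"
    and g: "0 < g" "b + 2 * g < 1" "1 < a - 2 * g"
    and "\<exists>U0. 0 \<in> interior U0 \<and> (\<forall>x\<in>U0. \<forall>y\<in>U0. nrm (N x - N y) \<le> g * nrm (x - y))"
    using wh unfolding weakly_hyperbolic_decomp_def by blast+
  then obtain U0 where U0: "0 \<in> interior U0"
    and lip: "\<And>x y. x \<in> U0 \<Longrightarrow> y \<in> U0 \<Longrightarrow> nrm (N x - N y) \<le> g * nrm (x - y)"
    by blast
  obtain d where "0 < d" and d: "ball 0 d \<subseteq> U0"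
    using U0 by (meson mem_interior)
  have N0: "N 0 = 0" using dec[of 0] fix_p by simp
  have small: "nrm (N (x - p)) \<le> g * nrm (x - p)" if "norm (x - p) < d" for x
    using lip[of "x - p" 0] d that \<open>0 < d\<close> N0 by (auto simp: subset_eq)
  have T: "T x - p = blinfun_apply L (x - p) + N (x - p)" for x
    using dec[of "x - p"] by simp
  have g': "b + g < 1" "1 < a - g" using g by auto
  show ?thesis
  proof (intro exI[of _ d] conjI allI impI \<open>0 < d\<close>)
    fix x assume "norm (x - p) < d"
    note step = hyperbolic_operator_cone_step[OF hyp g(1) g' small[OF this], folded T]
    {
      assume "nrm (proj_s L (x - p)) \<le> nrm (proj_u L (x - p))"
      from step(1)[OF this]
      show "(a - g) * nrm (proj_u L (x - p)) \<le> nrm (proj_u L (T x - p))"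
        and "nrm (proj_s L (T x - p)) \<le> nrm (proj_u L (T x - p))" by simp_all
    next
      assume "nrm (proj_u L (x - p)) \<le> nrm (proj_s L (x - p))"
      then show "nrm (proj_s L (T x - p)) \<le> (b + g) * nrm (proj_s L (x - p))" by (rule step(2))
    }
  qed
qed

section \<open>Solutions that stay near the equilibrium\<close>

lemma tendsto_if_equivalent_norm_tendsto_0:
  assumes nrm: "equivalent_norm nrm" and lim: "((\<lambda>n. nrm (f n - p)) \<longlongrightarrow> 0) F"
  shows "(f \<longlongrightarrow> p) F"
proof -
  obtain c where "0 < c" and c: "\<forall>x. c * norm x \<le> nrm x"
    using nrm unfolding equivalent_norm_def by blast
  have "((\<lambda>n. inverse c * nrm (f n - p)) \<longlongrightarrow> 0) F"
    using lim by (rule tendsto_mult_right_zero)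
  moreover have "norm (f n - p) \<le> inverse c * nrm (f n - p)" for n
    using c[rule_format, of "f n - p"] \<open>0 < c\<close> by (simp add: field_simps)
  then have "eventually (\<lambda>n. norm (f n - p) \<le> inverse c * nrm (f n - p)) F"
    by (simp add: always_eventually)
  ultimately have "((\<lambda>n. f n - p) \<longlongrightarrow> 0) F"
    by (rule Lim_null_comparison[rotated])
  then show ?thesis by (simp add: LIM_zero_iff)
qed

lemma tendsto_at_top_int_if_sequentially:
  fixes f :: "int \<Rightarrow> 'a::topological_space"
  assumes "(\<lambda>n. f (int n)) \<longlonglongrightarrow> l"
  shows "(f \<longlongrightarrow> l) at_top"
proof -
  have "((\<lambda>m. f (int (nat m))) \<longlongrightarrow> l) at_top"
    using assms filterlim_nat_sequentially by (rule filterlim_compose)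
  moreover have "eventually (\<lambda>m. f (int (nat m)) = f m) at_top"
    using eventually_ge_at_top[of 0] by eventually_elim simp
  ultimately show ?thesis by (rule Lim_transform_eventually)
qed

lemma tendsto_at_bot_int_if_sequentially:
  fixes f :: "int \<Rightarrow> 'a::topological_space"
  assumes "(\<lambda>n. f (- int n)) \<longlonglongrightarrow> l"
  shows "(f \<longlongrightarrow> l) at_bot"
proof -
  have "((\<lambda>m. f (- m)) \<longlongrightarrow> l) at_top"
    using assms by (rule tendsto_at_top_int_if_sequentially)
  moreover have "filterlim (\<lambda>m::int. - m) at_top at_bot"
    unfolding filterlim_at_top
  proof
    fix k :: int
    show "eventually (\<lambda>m. k \<le> - m) at_bot"
      using eventually_le_at_bot[of "- k"] by eventually_elim simp
  qed
  ultimately have "((\<lambda>m. f (- (- m))) \<longlongrightarrow> l) at_bot" by (rule filterlim_compose)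
  then show ?thesis by simp
qed

theorem theorem3p11:
  fixes T :: "'a::banach \<Rightarrow> 'a" and x_star :: 'a
  assumes "continuous_on UNIV T"
    and "asymptotically_compact T"
    and "L_hyperbolic T x_star"
  shows "\<exists>\<delta>>0. \<forall>\<xi> :: int \<Rightarrow> 'a. global_solution T \<xi> \<longrightarrow>
      ((\<forall>m\<ge>0. norm (\<xi> m - x_star) < \<delta>) \<longrightarrow> (\<xi> \<longlongrightarrow> x_star) at_top) \<and>
      ((\<forall>m\<le>0. norm (\<xi> m - x_star) < \<delta>) \<longrightarrow> (\<xi> \<longlongrightarrow> x_star) at_bot)"
proof -
  obtain L a b nrm N g where wh: "weakly_hyperbolic_decomp L a b nrm T x_star N g"
    using assms(3) unfolding L_hyperbolic_def by blast
  then have hyp: "hyperbolic_operator L a b nrm" and g: "0 < g" "b + 2 * g < 1" "1 < a - 2 * g"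
    unfolding weakly_hyperbolic_decomp_def by blast+
  then have nrm: "equivalent_norm nrm" and "0 < b" unfolding hyperbolic_operator_def by blast+
  have rates: "1 < a - g" "0 < b + g" "b + g < 1" using g \<open>0 < b\<close> by auto
  obtain C where "0 < C" and C: "\<forall>x. nrm x \<le> C * norm x"
    using nrm unfolding equivalent_norm_def by blast
  obtain d where "0 < d"
    and step: "\<forall>x. norm (x - x_star) < d \<longrightarrow>
      (nrm (proj_s L (x - x_star)) \<le> nrm (proj_u L (x - x_star)) \<longrightarrow>
        (a - g) * nrm (proj_u L (x - x_star)) \<le> nrm (proj_u L (T x - x_star)) \<and>
        nrm (proj_s L (T x - x_star)) \<le> nrm (proj_u L (T x - x_star))) \<and>
      (nrm (proj_u L (x - x_star)) \<le> nrm (proj_s L (x - x_star)) \<longrightarrow>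
        nrm (proj_s L (T x - x_star)) \<le> (b + g) * nrm (proj_s L (x - x_star)))"
    using weakly_hyperbolic_cone_step[OF wh] by (elim exE conjE)
  have unstable: "(a - g) * nrm (proj_u L (x - x_star)) \<le> nrm (proj_u L (T x - x_star)) \<and>
      nrm (proj_s L (T x - x_star)) \<le> nrm (proj_u L (T x - x_star))"
    if "norm (x - x_star) < d" "nrm (proj_s L (x - x_star)) \<le> nrm (proj_u L (x - x_star))" for x
    using step[rule_format, OF that(1)] that(2) by simp
  have stable: "nrm (proj_s L (T x - x_star)) \<le> (b + g) * nrm (proj_s L (x - x_star))"
    if "norm (x - x_star) < d" "nrm (proj_u L (x - x_star)) \<le> nrm (proj_s L (x - x_star))" for x
    using step[rule_format, OF that(1)] that(2) by simp
  have bound: "nrm (proj_u L (x - x_star)) \<le> C * d" "nrm (proj_s L (x - x_star)) \<le> C * d"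
    if "norm (x - x_star) < d" for x
  proof -
    have "nrm (x - x_star) \<le> C * norm (x - x_star)" using C by blast
    also have "\<dots> \<le> C * d" using that \<open>0 < C\<close> by simp
    finally show "nrm (proj_u L (x - x_star)) \<le> C * d" "nrm (proj_s L (x - x_star)) \<le> C * d"
      using hyperbolic_operator_norm_eq_max[OF hyp, of "x - x_star"] by auto
  qed
  show ?thesis
  proof (intro exI[of _ d] conjI allI impI \<open>0 < d\<close>)
    fix \<xi> :: "int \<Rightarrow> 'a"
    assume "global_solution T \<xi>"
    then have sol: "T (\<xi> m) = \<xi> (m + 1)" for m by (simp add: global_solution_def)
    let ?u = "\<lambda>m. nrm (proj_u L (\<xi> m - x_star))" and ?s = "\<lambda>m. nrm (proj_s L (\<xi> m - x_star))"
    note nonneg = equivalent_norm_nonneg[OF nrm]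
    {
      assume near: "\<forall>m\<ge>0. norm (\<xi> m - x_star) < d"
      have Suc: "\<xi> (int (Suc n)) = T (\<xi> (int n))" for n by (simp add: sol add.commute)
      have "(\<lambda>n. max (?u (int n)) (?s (int n))) \<longlonglongrightarrow> 0"
        by (rule cone_dichotomy_forward[where M = "C * d", OF rates(1) less_imp_le[OF rates(2)] rates(3)])
          (auto simp: Suc nonneg near bound unstable stable simp del: of_nat_Suc)
      then have "(\<lambda>n. nrm (\<xi> (int n) - x_star)) \<longlonglongrightarrow> 0"
        by (simp flip: hyperbolic_operator_norm_eq_max[OF hyp])
      then have "(\<lambda>n. \<xi> (int n)) \<longlonglongrightarrow> x_star"
        by (rule tendsto_if_equivalent_norm_tendsto_0[OF nrm])
      then show "(\<xi> \<longlongrightarrow> x_star) at_top" by (rule tendsto_at_top_int_if_sequentially)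
    next
      assume near: "\<forall>m\<le>0. norm (\<xi> m - x_star) < d"
      have pred: "\<xi> (- int n) = T (\<xi> (- int (Suc n)))" for n by (simp add: sol)
      have "(\<lambda>n. max (?u (- int n)) (?s (- int n))) \<longlonglongrightarrow> 0"
      proof (rule cone_dichotomy_backward[where M = "C * d", OF rates])
        fix n
        show "(a - g) * ?u (- int (Suc n)) \<le> ?u (- int n) \<and> ?s (- int n) \<le> ?u (- int n)"
          if "?s (- int (Suc n)) \<le> ?u (- int (Suc n))"
          unfolding pred[of n] using near that by (intro unstable) auto
        show "?s (- int n) \<le> (b + g) * ?s (- int (Suc n))"
          if "?u (- int (Suc n)) \<le> ?s (- int (Suc n))"
          unfolding pred[of n] using near that by (intro stable) auto
      qed (auto simp: nonneg near bound)
      then have "(\<lambda>n. nrm (\<xi> (- int n) - x_star)) \<longlonglongrightarrow> 0"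
        by (simp flip: hyperbolic_operator_norm_eq_max[OF hyp])
      then have "(\<lambda>n. \<xi> (- int n)) \<longlonglongrightarrow> x_star"
        by (rule tendsto_if_equivalent_norm_tendsto_0[OF nrm])
      then show "(\<xi> \<longlongrightarrow> x_star) at_bot" by (rule tendsto_at_bot_int_if_sequentially)
    }
  qed
qed

end
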